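(* Let a system with coordinates $q=(q_1,\dots,q_n)$, $n=m+k$, be subject to the kinematic constraints $\dot q_{m+\nu}=\alpha_\nu(q_1,\dots,q_n,\dot q_1,\dots,\dot q_m,t)$, $\nu=1,\dots,k$, and to active forces $\mathcal F=\nabla_{\bf X}\mathcal U({\bf X},t)$ coming from a potential $\mathcal U$, so that $\mathcal F^{(q_i)}=\partial U/\partial q_i$ for $i=1,\dots,n$, where $U(q_1,\dots,q_n,t)=\mathcal U({\bf X}(q_1,\dots,q_n,t),t)$. Let $\mathcal L^*=T^*+U$. Then the equations of motion $$\frac{d}{dt}\frac{\partial T^*}{\partial \dot q_i}-\frac{\partial T^*}{\partial q_i}-\sum_{\nu=1}^k\frac{\partial T^*}{\partial q_{m+\nu}}\frac{\partial\alpha_\nu}{\partial\dot q_i}-\sum_{\nu=1}^k B_i^\nu\frac{\partial T}{\partial\dot q_{m+\nu}}=\mathcal F^{(q_i)}+\sum_{\nu=1}^k\frac{\partial\alpha_\nu}{\partial\dot q_i}\mathcal F^{(q_{m+\nu})},\qquad i=1,\dots,m,$$ joined with the constraint equations, entail (i.e. along every solution one has) $$\frac{d}{dt}\left(\sum_{i=1}^m\dot q_i\frac{\partial\mathcal L^*}{\partial\dot q_i}-\mathcal L^*\right)-\sum_{\nu=1}^k(\overline\alpha_\nu-\alpha_\nu)\frac{\partial\mathcal L^*}{\partial q_{m+\nu}}-\sum_{\nu=1}^k\overline B_\nu\frac{\partial T}{\partial\dot q_{m+\nu}}=-\frac{\partial\mathcal L^*}{\partial t},$$ where $$\overline\alpha_\nu(q_1,\dots,q_n,\dot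 q_1,\dots,\dot q_m,t)=\sum_{i=1}^m\dot q_i\frac{\partial\alpha_\nu}{\partial\dot q_i},$$ $$\overline B_\nu=\sum_{r=1}^m\dot q_r\left(\frac{\partial\overline\alpha_\nu}{\partial q_r}-\frac{\partial\alpha_\nu}{\partial q_r}\right)+\sum_{\mu=1}^k\left(\alpha_\mu\frac{\partial\overline\alpha_\nu}{\partial q_{m+\mu}}-\overline\alpha_\mu\frac{\partial\alpha_\nu}{\partial q_{m+\mu}}\right)+\sum_{r=1}^m\ddot q_r\left(\frac{\partial\overline\alpha_\nu}{\partial\dot q_r}-\frac{\partial\alpha_\nu}{\partial\dot q_r}\right)+\frac{\partial\overline\alpha_\nu}{\partial t}$$ $$=\frac{d}{dt}(\overline\alpha_\nu-\alpha_\nu)-\sum_{\mu=1}^k\frac{\partial\alpha_\nu}{\partial q_{m+\mu}}(\overline\alpha_\mu-\alpha_\mu)+\frac{\partial\alpha_\nu}{\partial t}.$$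
   Context: All functions are assumed as smooth as needed. ${\bf X}(q_1,\dots,q_n,t)\in\mathbb R^{3N}$ gives the positions of $N$ material points $P_1,\dots,P_N$ with masses $M_1,\dots,M_N>0$, and ${\bf X}^{(\mathsf M)}=(M_1P_1,\dots,M_NP_N)$. The kinetic energy is $T(q_1,\dots,q_n,\dot q_1,\dots,\dot q_n,t)=\frac12\dot{\bf X}^{(\mathsf M)}\cdot\dot{\bf X}$, with $\dot{\bf X}=\sum_{i=1}^n\frac{\partial{\bf X}}{\partial q_i}\dot q_i+\frac{\partial{\bf X}}{\partial t}$ (and the same for ${\bf X}^{(\mathsf M)}$). For active forces $\mathcal F\in\mathbb R^{3N}$, the generalized forces are $\mathcal F^{(q_j)}=\mathcal F\cdot\frac{\partial{\bf X}}{\partial q_j}$, $j=1,\dots,n$. Given the constraint functions $\alpha_\nu(q_1,\dots,q_n,\dot q_1,\dots,\dot q_m,t)$, $\nu=1,\dots,k$, the restricted kinetic energy is $T^*(q_1,\dots,q_n,\dot q_1,\dots,\dot q_m,t)=T(q_1,\dots,q_n,\dot q_1,\dots,\dot q_m,\alpha_1,\dots,\alpha_k,t)$, and $\mathcal L^*(q_1,\dots,q_n,\dot q_1,\dots,\dot q_m,t)=T^*(q_1,\dots,q_n,\dot q_1,\dots,\dot q_m,t)+U(q_1,\dots,q_n,t)$. In $\partial T/\partial\dot q_{m+\nu}$ the derivative of the unrestricted $T$ is taken first and then $\dot q_{m+1},\dots,\dot q_n$ are replaced by $\alpha_1,\dots,\alpha_k$. Partial derivatives of $T^*,\mathcal L^*,\alpha_\nu,\overline\alpha_\nu$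 are with respect to the independent arguments $(q_1,\dots,q_n,\dot q_1,\dots,\dot q_m,t)$. The coefficients in the equations of motion are $$B_i^\nu=\sum_{r=1}^m\left(\frac{\partial^2\alpha_\nu}{\partial\dot q_i\partial q_r}\dot q_r+\frac{\partial^2\alpha_\nu}{\partial\dot q_i\partial\dot q_r}\ddot q_r\right)-\frac{\partial\alpha_\nu}{\partial q_i}+\sum_{\mu=1}^k\left(\frac{\partial^2\alpha_\nu}{\partial\dot q_i\partial q_{m+\mu}}\alpha_\mu-\frac{\partial\alpha_\mu}{\partial\dot q_i}\frac{\partial\alpha_\nu}{\partial q_{m+\mu}}\right)+\frac{\partial^2\alpha_\nu}{\partial\dot q_i\partial t}.$$ The total derivative $\frac{d}{dt}$ is taken along a motion $t\mapsto q(t)$ satisfying the constraints. *)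

theory Defs
  imports "HOL-Analysis.Analysis"
begin

text \<open>
  Coordinates are indexed by the sum type \<^typ>\<open>'m + 'k\<close>: \<^term>\<open>Inl r\<close> stands for the
  \<open>r\<close>-th coordinate with independent velocity, \<^term>\<open>Inr \<nu>\<close> for the \<open>(m+\<nu>)\<close>-th one.
  The functions of the theory take as argument one of the tuples
  \<open>(q, t)\<close>, \<open>(q, w, t)\<close> with all \<open>n = m + k\<close> velocities \<open>w\<close>, or
  \<open>(q, v, t)\<close> with the \<open>m\<close> independent velocities \<open>v\<close> only.
\<close>

type_synonym 'N points = "(real ^ 3) ^ 'N"
type_synonym ('m, 'k) conf = "(real ^ ('m + 'k)) \<times> real"
type_synonym ('m, 'k) full_state = "(real ^ ('m + 'k)) \<times> (real ^ ('m + 'k)) \<times> real"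
type_synonym ('m, 'k) state = "(real ^ ('m + 'k)) \<times> (real ^ 'm) \<times> real"

text \<open>Partial derivative along a coordinate direction \<open>b\<close> of the argument space.\<close>

definition partial ::
  "'a::real_normed_vector \<Rightarrow> ('a \<Rightarrow> 'b::real_normed_vector) \<Rightarrow> 'a \<Rightarrow> 'b" where
  "partial b f x = vector_derivative (\<lambda>s. f (x + s *\<^sub>R b)) (at 0)"

text \<open>The class \<open>C\<^sup>p\<close> on an open set.\<close>

primrec Cn_on :: "nat \<Rightarrow> ('a::euclidean_space \<Rightarrow> 'b::real_normed_vector) \<Rightarrow> 'a set \<Rightarrow> bool" where
  "Cn_on 0 f S \<longleftrightarrow> continuous_on S f"
| "Cn_on (Suc p) f S \<longleftrightarrow> f differentiable_on S \<and> (\<forall>b\<in>Basis. Cn_on p (partial b f) S)"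

text \<open>
  Coordinate directions: \<open>cq\<close>, \<open>ct\<close> for functions of \<open>(q, t)\<close>;
  \<open>dq\<close>, \<open>dv\<close>, \<open>dt\<close> for functions of coordinates, velocities and time.
  The velocity slot has \<open>m\<close> or \<open>n\<close> components depending on the type.
\<close>

definition cq :: "'i::finite \<Rightarrow> (real ^ 'i) \<times> real" where
  "cq i = (axis i 1, 0)"

definition ct :: "(real ^ 'i::finite) \<times> real" where
  "ct = (0, 1)"

definition dq :: "'i::finite \<Rightarrow> (real ^ 'i) \<times> (real ^ 'j::finite) \<times> real" where
  "dq i = (axis i 1, 0, 0)"

definition dv :: "'j::finite \<Rightarrow> (real ^ 'i::finite) \<times> (real ^ 'j) \<times> real" where
  "dv j = (0, axis j 1, 0)"

definition dt :: "(real ^ 'i::finite) \<times> (real ^ 'j::finite) \<times> real" where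
  "dt = (0, 0, 1)"

definition mass_weighted ::
  "('N::finite \<Rightarrow> real) \<Rightarrow> (('m::finite, 'k::finite) conf \<Rightarrow> 'N points) \<Rightarrow>
   ('m, 'k) conf \<Rightarrow> 'N points" where
  "mass_weighted M X c = (\<chi> a. M a *\<^sub>R (X c $ a))"

definition velocity ::
  "(('m::finite, 'k::finite) conf \<Rightarrow> 'N::finite points) \<Rightarrow> ('m, 'k) full_state \<Rightarrow> 'N points" where
  "velocity X = (\<lambda>(q, w, t).
     (\<Sum>i\<in>UNIV. (w $ i) *\<^sub>R partial (cq i) X (q, t)) + partial ct X (q, t))"

definition kinetic ::
  "('N::finite \<Rightarrow> real) \<Rightarrow> (('m::finite, 'k::finite) conf \<Rightarrow> 'N points) \<Rightarrow>
   ('m, 'k) full_state \<Rightarrow> real" where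
  "kinetic M X z = 1 / 2 * (velocity (mass_weighted M X) z \<bullet> velocity X z)"

definition generalized_force ::
  "('N::finite points \<times> real \<Rightarrow> 'N points) \<Rightarrow> (('m::finite, 'k::finite) conf \<Rightarrow> 'N points) \<Rightarrow>
   ('m + 'k) \<Rightarrow> ('m, 'k) conf \<Rightarrow> real" where
  "generalized_force F X j = (\<lambda>(q, t). F (X (q, t), t) \<bullet> partial (cq j) X (q, t))"

definition potential ::
  "('N::finite points \<times> real \<Rightarrow> real) \<Rightarrow> (('m::finite, 'k::finite) conf \<Rightarrow> 'N points) \<Rightarrow>
   ('m, 'k) conf \<Rightarrow> real" where
  "potential UX X = (\<lambda>(q, t). UX (X (q, t), t))"

definition constrained ::
  "('k::finite \<Rightarrow> ('m::finite, 'k) state \<Rightarrow> real) \<Rightarrow> ('m, 'k) state \<Rightarrow> ('m, 'k) full_state" where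
  "constrained \<alpha> = (\<lambda>(q, v, t).
     (q, (\<chi> j. case j of Inl r \<Rightarrow> v $ r | Inr \<nu> \<Rightarrow> \<alpha> \<nu> (q, v, t)), t))"

definition kinetic_star ::
  "('N::finite \<Rightarrow> real) \<Rightarrow> (('m::finite, 'k::finite) conf \<Rightarrow> 'N points) \<Rightarrow>
   ('k \<Rightarrow> ('m, 'k) state \<Rightarrow> real) \<Rightarrow> ('m, 'k) state \<Rightarrow> real" where
  "kinetic_star M X \<alpha> z = kinetic M X (constrained \<alpha> z)"

definition lagrangian_star ::
  "('N::finite \<Rightarrow> real) \<Rightarrow> (('m::finite, 'k::finite) conf \<Rightarrow> 'N points) \<Rightarrow>
   ('N points \<times> real \<Rightarrow> real) \<Rightarrow>
   ('k \<Rightarrow> ('m, 'k) state \<Rightarrow> real) \<Rightarrow> ('m, 'k) state \<Rightarrow> real" where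
  "lagrangian_star M X UX \<alpha> = (\<lambda>(q, v, t).
     kinetic_star M X \<alpha> (q, v, t) + potential UX X (q, t))"

text \<open>
  The derivative of the unrestricted kinetic energy by the \<open>\<nu>\<close>-th dependent velocity,
  evaluated on the constraint.
\<close>

definition dependent_momentum ::
  "('N::finite \<Rightarrow> real) \<Rightarrow> (('m::finite, 'k::finite) conf \<Rightarrow> 'N points) \<Rightarrow>
   ('k \<Rightarrow> ('m, 'k) state \<Rightarrow> real) \<Rightarrow> 'k \<Rightarrow> ('m, 'k) state \<Rightarrow> real" where
  "dependent_momentum M X \<alpha> \<nu> z = partial (dv (Inr \<nu>)) (kinetic M X) (constrained \<alpha> z)"

text \<open>In the two coefficients below, \<open>a\<close> is the vector of the \<open>m\<close> independent accelerations.\<close>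

definition B_coeff ::
  "('k::finite \<Rightarrow> ('m::finite, 'k) state \<Rightarrow> real) \<Rightarrow> 'm \<Rightarrow> 'k \<Rightarrow>
   ('m, 'k) state \<Rightarrow> real ^ 'm \<Rightarrow> real" where
  "B_coeff \<alpha> i \<nu> = (\<lambda>(q, v, t) a. let z = (q, v, t) in
     (\<Sum>r\<in>UNIV. partial (dv i) (partial (dq (Inl r)) (\<alpha> \<nu>)) z * v $ r
              + partial (dv i) (partial (dv r) (\<alpha> \<nu>)) z * a $ r)
     - partial (dq (Inl i)) (\<alpha> \<nu>) z
     + (\<Sum>\<mu>\<in>UNIV. partial (dv i) (partial (dq (Inr \<mu>)) (\<alpha> \<nu>)) z * \<alpha> \<mu> z
              - partial (dv i) (\<alpha> \<mu>) z * partial (dq (Inr \<mu>)) (\<alpha> \<nu>) z)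
     + partial (dv i) (partial dt (\<alpha> \<nu>)) z)"

definition alpha_bar ::
  "('k::finite \<Rightarrow> ('m::finite, 'k) state \<Rightarrow> real) \<Rightarrow> 'k \<Rightarrow> ('m, 'k) state \<Rightarrow> real" where
  "alpha_bar \<alpha> \<nu> = (\<lambda>(q, v, t). \<Sum>i\<in>UNIV. v $ i * partial (dv i) (\<alpha> \<nu>) (q, v, t))"

definition B_bar ::
  "('k::finite \<Rightarrow> ('m::finite, 'k) state \<Rightarrow> real) \<Rightarrow> 'k \<Rightarrow>
   ('m, 'k) state \<Rightarrow> real ^ 'm \<Rightarrow> real" where
  "B_bar \<alpha> \<nu> = (\<lambda>(q, v, t) a. let z = (q, v, t) in
     (\<Sum>r\<in>UNIV. v $ r *
        (partial (dq (Inl r)) (alpha_bar \<alpha> \<nu>) z - partial (dq (Inl r)) (\<alpha> \<nu>) z))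
     + (\<Sum>\<mu>\<in>UNIV. \<alpha> \<mu> z * partial (dq (Inr \<mu>)) (alpha_bar \<alpha> \<nu>) z
              - alpha_bar \<alpha> \<mu> z * partial (dq (Inr \<mu>)) (\<alpha> \<nu>) z)
     + (\<Sum>r\<in>UNIV. a $ r *
        (partial (dv r) (alpha_bar \<alpha> \<nu>) z - partial (dv r) (\<alpha> \<nu>) z))
     + partial dt (alpha_bar \<alpha> \<nu>) z)"

definition free_part :: "real ^ ('m::finite + 'k::finite) \<Rightarrow> real ^ 'm" where
  "free_part w = (\<chi> r. w $ Inl r)"

end

theory Submission
  imports Defs
begin

text \<open>
  The balance is the usual energy identity of Lagrangian mechanics, with a correction for the
  velocities that the constraints determine.  Differentiating
  \<open>\<Sum>\<^sub>i v\<^sub>i \<partial>L/\<partial>v\<^sub>i - L\<close> along the motion, the terms with the accelerations cancel.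
  What remains is \<open>\<Sum>\<^sub>i v\<^sub>i d/ds (\<partial>T/\<partial>v\<^sub>i)\<close> minus the rate of change of \<open>L\<close> caused by the
  coordinates and by time, in which the dependent coordinates move with velocity \<open>\<alpha> \<nu>\<close>.
  Multiplying the \<open>i\<close>-th equation of motion by \<open>v\<^sub>i\<close> and summing expresses the first part by
  derivatives of \<open>L\<close> with respect to the coordinates, because the generalized forces are the
  partial derivatives of the potential (\<open>generalized_force_eq_partial_potential\<close>).  There the
  dependent coordinates appear with the weight \<open>\<Sum>\<^sub>i v\<^sub>i \<partial>\<alpha>\<^sub>\<nu>/\<partial>v\<^sub>i\<close>, that is \<open>alpha_bar\<close>, instead
  of \<open>\<alpha> \<nu>\<close>.  The difference of these two weights gives the first correction; the second one
  appears as \<open>\<Sum>\<^sub>i v\<^sub>i B_coeff\<close>.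

  The algebraic core is therefore \<open>B_bar_eq_sum_B_coeff\<close>: contracting \<open>B_coeff\<close> with the
  velocities gives \<open>B_bar\<close>.  In \<open>B_coeff\<close> the derivative by a velocity is the outer one, while
  differentiating \<open>alpha_bar\<close> makes it the inner one, so the identity rests on the symmetry of
  second partial derivatives (\<open>partial_commute\<close>).  The explicit shape of the kinetic energy
  enters only through its regularity: along a motion that is just twice differentiable,
  \<open>\<partial>T/\<partial>v\<^sub>i\<close> must have a time derivative (\<open>kinetic_star_differentiable\<close>).  The formula of
  \<open>B_bar\<close> as a time derivative of \<open>alpha_bar - \<alpha>\<close> is the chain rule
  (\<open>has_real_derivative_along_state\<close>) with the constraints inserted for the dependent velocities.
\<close>

section \<open>Partial derivatives and the chain rule\<close>

lemma partial_eq_has_derivative: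
  assumes "(f has_derivative f') (at x)"
  shows "partial b f x = f' b"
proof -
  interpret f': bounded_linear f'
    using assms by (rule has_derivative_bounded_linear)
  have line: "((\<lambda>s. x + s *\<^sub>R b) has_derivative (\<lambda>s. s *\<^sub>R b)) (at 0)"
    by (auto intro!: derivative_eq_intros)
  have "(f has_derivative f') (at (x + 0 *\<^sub>R b))"
    using assms by simp
  from has_derivative_compose[OF line this]
  have "((\<lambda>s. f (x + s *\<^sub>R b)) has_vector_derivative f' b) (at 0)"
    by (simp add: has_vector_derivative_def f'.scaleR)
  then show ?thesis
    unfolding partial_def by (rule vector_derivative_at)
qed

lemma partial_has_vector_derivative:
  assumes "f differentiable (at (x + s *\<^sub>R b))"
  shows "((\<lambda>s. f (x + s *\<^sub>R b)) has_vector_derivative partial b f (x + s *\<^sub>R b)) (at s)"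
proof -
  obtain f' where f': "(f has_derivative f') (at (x + s *\<^sub>R b))"
    using assms unfolding differentiable_def by blast
  interpret f': bounded_linear f'
    using f' by (rule has_derivative_bounded_linear)
  have line: "((\<lambda>s. x + s *\<^sub>R b) has_derivative (\<lambda>s. s *\<^sub>R b)) (at s)"
    by (auto intro!: derivative_eq_intros)
  show ?thesis
    using has_derivative_compose[OF line f'] partial_eq_has_derivative[OF f']
    by (simp add: has_vector_derivative_def f'.scaleR)
qed

text \<open>
  The positions are smooth on an open set only, so closed formulas for the kinetic energy hold
  only over that set; this transfers derivatives from such a formula.
\<close>

lemma partial_cong_open:
  assumes "open S" "x \<in> S" "\<And>y. y \<in> S \<Longrightarrow> f y = g y"
    and "g differentiable (at x)"
  shows "f differentiable (at x)" "partial b f x = partial b g x"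
proof -
  obtain g' where g': "(g has_derivative g') (at x)"
    using assms(4) unfolding differentiable_def by blast
  have f': "(f has_derivative g') (at x)"
    using has_derivative_transform_within_open[OF g' assms(1,2)] assms(3) by metis
  then show "f differentiable (at x)"
    unfolding differentiable_def by blast
  show "partial b f x = partial b g x"
    using partial_eq_has_derivative[OF f'] partial_eq_has_derivative[OF g'] by metis
qed

text \<open>
  The kinetic energy is half of such a quadratic expression, with \<open>A\<close> the multiplication by
  the masses.
\<close>

lemma partial_inner_linear:
  fixes V :: "'a::real_normed_vector \<Rightarrow> 'b::real_inner"
  assumes "bounded_linear A" and "V differentiable (at x)"
  shows "(\<lambda>x. A (V x) \<bullet> V x) differentiable (at x)"
    and "partial b (\<lambda>x. A (V x) \<bullet> V x) x = A (V x) \<bullet> partial b V x + A (partial b V x) \<bullet> V x"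
proof -
  obtain V' where V': "(V has_derivative V') (at x)"
    using assms(2) unfolding differentiable_def by blast
  have d: "((\<lambda>x. A (V x) \<bullet> V x) has_derivative (\<lambda>h. A (V x) \<bullet> V' h + A (V' h) \<bullet> V x)) (at x)"
    by (rule has_derivative_inner[OF bounded_linear.has_derivative[OF assms(1) V'] V'])
  then show "(\<lambda>x. A (V x) \<bullet> V x) differentiable (at x)"
    unfolding differentiable_def by blast
  show "partial b (\<lambda>x. A (V x) \<bullet> V x) x = A (V x) \<bullet> partial b V x + A (partial b V x) \<bullet> V x"
    using partial_eq_has_derivative[OF d] partial_eq_has_derivative[OF V'] by metis
qed

text \<open>
  The total derivative \<open>d/ds\<close> along a curve in the state space, in coordinates.  The velocity
  slot follows any curve \<open>v\<close>, so that it can hold the independent velocities only.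
\<close>

lemma has_real_derivative_along_state:
  fixes f :: "(real ^ 'i::finite) \<times> (real ^ 'j::finite) \<times> real \<Rightarrow> real"
  assumes "f differentiable (at (q s, v s, s))"
    and "(q has_vector_derivative w) (at s)" and "(v has_vector_derivative a) (at s)"
  shows "((\<lambda>s. f (q s, v s, s)) has_real_derivative
    (\<Sum>j\<in>UNIV. w $ j * partial (dq j) f (q s, v s, s))
    + (\<Sum>r\<in>UNIV. a $ r * partial (dv r) f (q s, v s, s))
    + partial dt f (q s, v s, s)) (at s)"
proof -
  obtain f' where f': "(f has_derivative f') (at (q s, v s, s))"
    using assms(1) unfolding differentiable_def by blast
  interpret f': bounded_linear f'
    using f' by (rule has_derivative_bounded_linear)
  have curve: "((\<lambda>s. (q s, v s, s)) has_derivative (\<lambda>h. (h *\<^sub>R w, h *\<^sub>R a, h))) (at s)"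
    using assms(2,3) unfolding has_vector_derivative_def
    by (intro has_derivative_Pair has_derivative_ident)
  have q_part: "(u, 0, 0) = (\<Sum>j\<in>UNIV. u $ j *\<^sub>R (dq j :: (real ^ 'i) \<times> (real ^ 'j) \<times> real))" for u
    by (simp add: dq_def prod_eq_iff fst_sum snd_sum vec_eq_iff axis_def if_distrib sum.If_cases cong: if_cong)
  have v_part: "(0, u, 0) = (\<Sum>r\<in>UNIV. u $ r *\<^sub>R (dv r :: (real ^ 'i) \<times> (real ^ 'j) \<times> real))" for u
    by (simp add: dv_def prod_eq_iff fst_sum snd_sum vec_eq_iff axis_def if_distrib sum.If_cases cong: if_cong)
  have "(h *\<^sub>R w, h *\<^sub>R a, h) = h *\<^sub>R ((w, 0, 0) + (0, a, 0) + dt)" for h :: real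
    by (simp add: dt_def)
  then have "f' (h *\<^sub>R w, h *\<^sub>R a, h)
    = h * ((\<Sum>j\<in>UNIV. w $ j * f' (dq j)) + (\<Sum>r\<in>UNIV. a $ r * f' (dv r)) + f' dt)" for h :: real
    by (simp add: q_part v_part f'.add f'.scaleR f'.sum)
  then show ?thesis
    using has_derivative_compose[OF curve f'] partial_eq_has_derivative[OF f']
    by (simp add: has_field_derivative_def mult_commute_abs)
qed

lemma sum_over_sum_type:
  fixes g :: "'m::finite + 'k::finite \<Rightarrow> 'a::comm_monoid_add"
  shows "(\<Sum>j\<in>UNIV. g j) = (\<Sum>r\<in>UNIV. g (Inl r)) + (\<Sum>\<nu>\<in>UNIV. g (Inr \<nu>))"
  by (simp add: UNIV_Plus_UNIV[symmetric] sum.Plus del: UNIV_Plus_UNIV)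

section \<open>Symmetry of second partial derivatives\<close>

lemma Cn_on_2_iff:
  "Cn_on 2 f S \<longleftrightarrow> f differentiable_on S \<and> (\<forall>b\<in>Basis. partial b f differentiable_on S
    \<and> (\<forall>c\<in>Basis. continuous_on S (partial c (partial b f))))"
  unfolding numeral_2_eq_2 Cn_on.simps by blast

lemma Cn_on_2_differentiable:
  assumes "open S" "x \<in> S" "Cn_on 2 f S"
  shows "f differentiable (at x)" "b \<in> Basis \<Longrightarrow> partial b f differentiable (at x)"
  using assms unfolding Cn_on_2_iff differentiable_on_def by (metis at_within_open)+

text \<open>
  Two applications of the mean value theorem, first to the difference in direction \<open>c\<close> as a
  function along \<open>b\<close>, then to \<open>partial b f\<close> along \<open>c\<close>.  The left-hand side is symmetric in \<open>b\<close>
  and \<open>c\<close>, and the right-hand side is not; this is what makes the mixed derivatives agree.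
\<close>

lemma second_difference_mean_value:
  fixes f :: "'a::real_normed_vector \<Rightarrow> real"
  assumes h: "h > 0"
    and f: "\<And>s t. 0 \<le> s \<Longrightarrow> s \<le> h \<Longrightarrow> 0 \<le> t \<Longrightarrow> t \<le> h \<Longrightarrow>
      f differentiable (at (x + s *\<^sub>R b + t *\<^sub>R c))"
    and fb: "\<And>s t. 0 \<le> s \<Longrightarrow> s \<le> h \<Longrightarrow> 0 \<le> t \<Longrightarrow> t \<le> h \<Longrightarrow>
      partial b f differentiable (at (x + s *\<^sub>R b + t *\<^sub>R c))"
  obtains s t where "0 < s" "s < h" "0 < t" "t < h"
    "f (x + h *\<^sub>R b + h *\<^sub>R c) - f (x + h *\<^sub>R b) - f (x + h *\<^sub>R c) + f x
     = h * h * partial c (partial b f) (x + s *\<^sub>R b + t *\<^sub>R c)"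
proof -
  have swap: "y + s *\<^sub>R b + t *\<^sub>R c = (y + t *\<^sub>R c) + s *\<^sub>R b" for y s t
    by simp
  let ?g = "\<lambda>s. f (x + s *\<^sub>R b + h *\<^sub>R c) - f (x + s *\<^sub>R b)"
  have g: "(?g has_real_derivative
      partial b f (x + s *\<^sub>R b + h *\<^sub>R c) - partial b f (x + s *\<^sub>R b)) (at s)"
    if "0 \<le> s" "s \<le> h" for s
    using partial_has_vector_derivative[of f "x + h *\<^sub>R c" s b]
      partial_has_vector_derivative[of f x s b] f[OF that, of h] f[OF that, of 0] h
    by (intro DERIV_diff) (simp_all add: swap has_real_derivative_iff_has_vector_derivative)
  obtain s where s: "0 < s" "s < h" "?g h - ?g 0 =
      (h - 0) * (partial b f (x + s *\<^sub>R b + h *\<^sub>R c) - partial b f (x + s *\<^sub>R b))"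
    using MVT2[of 0 h ?g, OF h g] by blast
  let ?k = "\<lambda>t. partial b f (x + s *\<^sub>R b + t *\<^sub>R c)"
  have k: "(?k has_real_derivative partial c (partial b f) (x + s *\<^sub>R b + t *\<^sub>R c)) (at t)"
    if "0 \<le> t" "t \<le> h" for t
    using partial_has_vector_derivative[of "partial b f" "x + s *\<^sub>R b" t c] fb[of s t] s that
    by (simp add: has_real_derivative_iff_has_vector_derivative)
  obtain t where t: "0 < t" "t < h" "?k h - ?k 0 =
      (h - 0) * partial c (partial b f) (x + s *\<^sub>R b + t *\<^sub>R c)"
    using MVT2[of 0 h ?k, OF h k] by blast
  show thesis
    using that[OF s(1,2) t(1,2)] s(3) t(3) by (simp add: algebra_simps)
qed

text \<open>
  Schwarz's theorem.  By the preceding lemma for \<open>(b, c)\<close> and for \<open>(c, b)\<close>, the two mixed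
  derivatives take a common value at two points arbitrarily near \<open>x\<close>, and both are continuous.
\<close>

lemma partial_commute:
  fixes f :: "'a::euclidean_space \<Rightarrow> real"
  assumes S: "open S" "x \<in> S" and f: "Cn_on 2 f S" and b: "b \<in> Basis" and c: "c \<in> Basis"
  shows "partial c (partial b f) x = partial b (partial c f) x"
proof (rule ccontr)
  let ?u = "partial c (partial b f)" and ?v = "partial b (partial c f)"
  assume ne: "?u x \<noteq> ?v x"
  define e where "e = \<bar>?u x - ?v x\<bar> / 2"
  have e: "e > 0"
    using ne by (simp add: e_def)
  have diff: "g differentiable (at y)" if "y \<in> S" "g \<in> {f, partial b f, partial c f}" for g y
    using Cn_on_2_differentiable[OF S(1) that(1) f] b c that(2) by blast
  have cont: "isCont ?u x" "isCont ?v x"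
    using f b c S unfolding Cn_on_2_iff by (metis continuous_on_eq_continuous_at)+
  obtain d1 where d1: "d1 > 0" "\<And>y. dist y x < d1 \<Longrightarrow> dist (?u y) (?u x) < e"
    using cont(1) e unfolding continuous_at_eps_delta by blast
  obtain d2 where d2: "d2 > 0" "\<And>y. dist y x < d2 \<Longrightarrow> dist (?v y) (?v x) < e"
    using cont(2) e unfolding continuous_at_eps_delta by blast
  obtain d3 where d3: "d3 > 0" "\<And>y. dist y x < d3 \<Longrightarrow> y \<in> S"
    using S unfolding open_dist by blast
  define d where "d = min d1 (min d2 d3)"
  \<comment> \<open>The square with sides \<open>h\<close> lies within distance \<open>2 * h < d\<close> of \<open>x\<close>, as \<open>b\<close> and \<open>c\<close> are unit vectors.\<close>
  define h where "h = d / 3"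
  have h: "h > 0"
    using d1 d2 d3 by (simp add: h_def d_def)
  have near: "dist (x + s *\<^sub>R b + t *\<^sub>R c) x < d" if "0 \<le> s" "s \<le> h" "0 \<le> t" "t \<le> h" for s t
  proof -
    have "norm (s *\<^sub>R b + t *\<^sub>R c) \<le> s + t"
      using norm_triangle_ineq[of "s *\<^sub>R b" "t *\<^sub>R c"] that b c by simp
    then show ?thesis
      using that h by (simp add: dist_norm h_def add.assoc)
  qed
  have swap: "x + s *\<^sub>R c + t *\<^sub>R b = x + t *\<^sub>R b + s *\<^sub>R c" for s t
    by simp
  have inS: "x + s *\<^sub>R b + t *\<^sub>R c \<in> S" "x + s *\<^sub>R c + t *\<^sub>R b \<in> S"
    if "0 \<le> s" "s \<le> h" "0 \<le> t" "t \<le> h" for s t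
    using near[OF that] near[OF that(3,4,1,2)] d3(2) unfolding swap[of s t] by (simp_all add: d_def)
  obtain s t where st: "0 < s" "s < h" "0 < t" "t < h"
    "f (x + h *\<^sub>R b + h *\<^sub>R c) - f (x + h *\<^sub>R b) - f (x + h *\<^sub>R c) + f x
     = h * h * ?u (x + s *\<^sub>R b + t *\<^sub>R c)"
    by (rule second_difference_mean_value[OF h, of f x b c]) (use diff inS in auto)
  obtain s' t' where st': "0 < s'" "s' < h" "0 < t'" "t' < h"
    "f (x + h *\<^sub>R c + h *\<^sub>R b) - f (x + h *\<^sub>R c) - f (x + h *\<^sub>R b) + f x
     = h * h * ?v (x + s' *\<^sub>R c + t' *\<^sub>R b)"
    by (rule second_difference_mean_value[OF h, of f x c b]) (use diff inS in auto)
  have "h * h * ?u (x + s *\<^sub>R b + t *\<^sub>R c) = h * h * ?v (x + s' *\<^sub>R c + t' *\<^sub>R b)"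
    using st(5) st'(5) unfolding swap[of h h] by linarith
  then have eq: "?u (x + s *\<^sub>R b + t *\<^sub>R c) = ?v (x + s' *\<^sub>R c + t' *\<^sub>R b)"
    using h by simp
  have "dist (?u (x + s *\<^sub>R b + t *\<^sub>R c)) (?u x) < e"
    using d1(2) near[of s t] st by (simp add: d_def)
  moreover have "dist (?v (x + s' *\<^sub>R c + t' *\<^sub>R b)) (?v x) < e"
    using d2(2) near[of t' s'] st' unfolding swap by (simp add: d_def)
  ultimately have "\<bar>?u x - ?v x\<bar> < 2 * e"
    unfolding eq dist_real_def by linarith
  then show False
    by (simp add: e_def)
qed

lemma coordinate_directions_in_Basis [simp]:
  "cq i \<in> Basis" "ct \<in> Basis" "dq i \<in> Basis" "dv j \<in> Basis" "dt \<in> Basis"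
  by (simp_all add: cq_def ct_def dq_def dv_def dt_def Basis_prod_def axis_in_Basis_iff image_iff zero_prod_def)

section \<open>The constraint functions\<close>

text \<open>
  The last summand comes from differentiating the explicit velocities, \<open>fst (snd b)\<close> being the
  velocity part of the direction \<open>b\<close>: it vanishes for coordinates and time, and it is the
  derivative of \<open>\<alpha> \<nu>\<close> itself for a velocity.
\<close>

lemma alpha_bar_derivative:
  fixes \<alpha> :: "'k::finite \<Rightarrow> ('m::finite, 'k) state \<Rightarrow> real"
  assumes "open D" "z \<in> D" "Cn_on 2 (\<alpha> \<nu>) D"
  shows "alpha_bar \<alpha> \<nu> differentiable (at z)"
    and "partial b (alpha_bar \<alpha> \<nu>) z =
      (\<Sum>i\<in>UNIV. fst (snd z) $ i * partial b (partial (dv i) (\<alpha> \<nu>)) z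
             + fst (snd b) $ i * partial (dv i) (\<alpha> \<nu>) z)"
proof -
  have "\<forall>i. \<exists>g'. (partial (dv i) (\<alpha> \<nu>) has_derivative g') (at z)"
    using Cn_on_2_differentiable(2)[OF assms] by (simp add: differentiable_def)
  then obtain g' where g': "\<And>i. (partial (dv i) (\<alpha> \<nu>) has_derivative g' i) (at z)"
    by metis
  have abar: "alpha_bar \<alpha> \<nu> = (\<lambda>z. \<Sum>i\<in>UNIV. fst (snd z) $ i * partial (dv i) (\<alpha> \<nu>) z)"
    by (auto simp: alpha_bar_def fun_eq_iff)
  have v: "((\<lambda>z :: ('m, 'k) state. fst (snd z) $ i) has_derivative (\<lambda>h. fst (snd h) $ i)) (at z)" for i
    by (intro bounded_linear_imp_has_derivative bounded_linear_compose[OF bounded_linear_vec_nth]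
        bounded_linear_compose[OF bounded_linear_fst] bounded_linear_snd)
  have d: "(alpha_bar \<alpha> \<nu> has_derivative
      (\<lambda>h. \<Sum>i\<in>UNIV. fst (snd z) $ i * g' i h + fst (snd h) $ i * partial (dv i) (\<alpha> \<nu>) z)) (at z)"
    unfolding abar by (intro has_derivative_sum has_derivative_mult v g')
  then show "alpha_bar \<alpha> \<nu> differentiable (at z)"
    unfolding differentiable_def by blast
  show "partial b (alpha_bar \<alpha> \<nu>) z =
      (\<Sum>i\<in>UNIV. fst (snd z) $ i * partial b (partial (dv i) (\<alpha> \<nu>)) z
             + fst (snd b) $ i * partial (dv i) (\<alpha> \<nu>) z)"
    using partial_eq_has_derivative[OF d] partial_eq_has_derivative[OF g'] by simp
qed

text \<open>
  By the symmetry of second derivatives, contracting the derivatives of \<open>partial b (\<alpha> \<nu>)\<close> by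
  the velocities with the velocities gives \<open>partial b (alpha_bar \<alpha> \<nu>)\<close> for coordinates and time.
  For \<open>b = dv r\<close> the product rule adds \<open>partial (dv r) (\<alpha> \<nu>)\<close>, which is why \<open>B_bar\<close> subtracts it.
\<close>

lemma B_bar_eq_sum_B_coeff:
  fixes \<alpha> :: "'k::finite \<Rightarrow> ('m::finite, 'k) state \<Rightarrow> real"
  assumes D: "open D" "z \<in> D" and \<alpha>: "Cn_on 2 (\<alpha> \<nu>) D"
  shows "B_bar \<alpha> \<nu> z a = (\<Sum>i\<in>UNIV. fst (snd z) $ i * B_coeff \<alpha> i \<nu> z a)"
proof -
  obtain q v t where z: "z = (q, v, t)"
    by (cases z)
  have v: "fst (snd z) = v"
    by (simp add: z)
  have directions: "fst (snd (dq j :: ('m, 'k) state)) = 0" "fst (snd (dv r :: ('m, 'k) state)) = axis r 1"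
    "fst (snd (dt :: ('m, 'k) state)) = 0" for j r
    by (simp_all add: dq_def dv_def dt_def)
  have comm: "partial b (partial (dv i) (\<alpha> \<nu>)) z = partial (dv i) (partial b (\<alpha> \<nu>)) z"
    if "b \<in> Basis" for b i
    using partial_commute[OF D \<alpha>] that by simp
  have bar_q: "partial (dq j) (alpha_bar \<alpha> \<nu>) z
      = (\<Sum>i\<in>UNIV. v $ i * partial (dv i) (partial (dq j) (\<alpha> \<nu>)) z)" for j
    using alpha_bar_derivative(2)[where \<alpha>=\<alpha> and \<nu>=\<nu>, OF D \<alpha>, of "dq j"] by (simp add: comm v directions)
  have bar_t: "partial dt (alpha_bar \<alpha> \<nu>) z
      = (\<Sum>i\<in>UNIV. v $ i * partial (dv i) (partial dt (\<alpha> \<nu>)) z)"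
    using alpha_bar_derivative(2)[where \<alpha>=\<alpha> and \<nu>=\<nu>, OF D \<alpha>, of dt] by (simp add: comm v directions)
  have bar_v: "partial (dv r) (alpha_bar \<alpha> \<nu>) z - partial (dv r) (\<alpha> \<nu>) z
      = (\<Sum>i\<in>UNIV. v $ i * partial (dv i) (partial (dv r) (\<alpha> \<nu>)) z)" for r
  proof -
    have "(\<Sum>i\<in>UNIV. axis r 1 $ i * partial (dv i) (\<alpha> \<nu>) z) = partial (dv r) (\<alpha> \<nu>) z"
      by (simp add: axis_def if_distrib[of "\<lambda>x. x * _"] cong: if_cong)
    then show ?thesis
      using alpha_bar_derivative(2)[where \<alpha>=\<alpha> and \<nu>=\<nu>, OF D \<alpha>, of "dv r"]
      by (simp add: comm[of "dv r"] v directions sum.distrib)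
  qed
  have bar: "alpha_bar \<alpha> \<mu> z = (\<Sum>i\<in>UNIV. v $ i * partial (dv i) (\<alpha> \<mu>) z)" for \<mu>
    by (simp add: alpha_bar_def z)
  have "(\<Sum>i\<in>UNIV. v $ i * B_coeff \<alpha> i \<nu> z a) =
      (\<Sum>i\<in>UNIV. v $ i * (\<Sum>r\<in>UNIV. partial (dv i) (partial (dq (Inl r)) (\<alpha> \<nu>)) z * v $ r))
    + (\<Sum>i\<in>UNIV. v $ i * (\<Sum>r\<in>UNIV. partial (dv i) (partial (dv r) (\<alpha> \<nu>)) z * a $ r))
    - (\<Sum>i\<in>UNIV. v $ i * partial (dq (Inl i)) (\<alpha> \<nu>) z)
    + ((\<Sum>i\<in>UNIV. v $ i * (\<Sum>\<mu>\<in>UNIV. partial (dv i) (partial (dq (Inr \<mu>)) (\<alpha> \<nu>)) z * \<alpha> \<mu> z))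
    - (\<Sum>i\<in>UNIV. v $ i * (\<Sum>\<mu>\<in>UNIV. partial (dv i) (\<alpha> \<mu>) z * partial (dq (Inr \<mu>)) (\<alpha> \<nu>) z)))
    + (\<Sum>i\<in>UNIV. v $ i * partial (dv i) (partial dt (\<alpha> \<nu>)) z)"
    unfolding B_coeff_def z
    by (simp add: Let_def sum.distrib sum_subtractf ring_distribs)
  also have "\<dots> =
      (\<Sum>r\<in>UNIV. v $ r * partial (dq (Inl r)) (alpha_bar \<alpha> \<nu>) z)
    + (\<Sum>r\<in>UNIV. a $ r * (partial (dv r) (alpha_bar \<alpha> \<nu>) z - partial (dv r) (\<alpha> \<nu>) z))
    - (\<Sum>i\<in>UNIV. v $ i * partial (dq (Inl i)) (\<alpha> \<nu>) z)
    + ((\<Sum>\<mu>\<in>UNIV. \<alpha> \<mu> z * partial (dq (Inr \<mu>)) (alpha_bar \<alpha> \<nu>) z)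
    - (\<Sum>\<mu>\<in>UNIV. alpha_bar \<alpha> \<mu> z * partial (dq (Inr \<mu>)) (\<alpha> \<nu>) z))
    + partial dt (alpha_bar \<alpha> \<nu>) z"
  proof -
    have swap: "(\<Sum>i\<in>UNIV. v $ i * (\<Sum>r\<in>UNIV. g i r * u r)) = (\<Sum>r\<in>UNIV. u r * (\<Sum>i\<in>UNIV. v $ i * g i r))"
      for g :: "'m \<Rightarrow> 'x::finite \<Rightarrow> real" and u
      unfolding sum_distrib_left by (subst sum.swap) (simp add: ac_simps)
    show ?thesis
      unfolding bar_q bar_v bar_t bar swap by (simp add: mult.commute)
  qed
  also have "\<dots> = B_bar \<alpha> \<nu> z a"
    unfolding B_bar_def z
    by (simp add: Let_def sum.distrib sum_subtractf ring_distribs)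
  finally show ?thesis
    by (simp add: z)
qed

section \<open>The restricted kinetic energy and the potential\<close>

definition mass_operator :: "('N::finite \<Rightarrow> real) \<Rightarrow> 'N points \<Rightarrow> 'N points" where
  "mass_operator M Y = (\<chi> a. M a *\<^sub>R (Y $ a))"

lemma bounded_linear_mass_operator: "bounded_linear (mass_operator M)"
  unfolding linear_conv_bounded_linear[symmetric]
  by (rule linearI) (simp_all add: mass_operator_def vec_eq_iff scaleR_right_distrib)

lemma velocity_mass_weighted:
  assumes "X differentiable (at (x, t))"
  shows "velocity (mass_weighted M X) (x, w, t) = mass_operator M (velocity X (x, w, t))"
proof -
  interpret A: bounded_linear "mass_operator M"
    by (rule bounded_linear_mass_operator)
  obtain X' where X': "(X has_derivative X') (at (x, t))"
    using assms unfolding differentiable_def by blast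
  have mw: "mass_weighted M X = (\<lambda>c. mass_operator M (X c))"
    by (simp add: fun_eq_iff mass_weighted_def mass_operator_def)
  have "partial b (mass_weighted M X) (x, t) = mass_operator M (partial b X (x, t))" for b
    using partial_eq_has_derivative[OF A.has_derivative[OF X']] partial_eq_has_derivative[OF X']
    unfolding mw by metis
  then show ?thesis
    by (simp add: velocity_def A.add A.sum A.scaleR)
qed

definition constrained_velocity ::
  "(('m::finite, 'k::finite) conf \<Rightarrow> 'N::finite points) \<Rightarrow> ('k \<Rightarrow> ('m, 'k) state \<Rightarrow> real) \<Rightarrow>
   ('m, 'k) state \<Rightarrow> 'N points" where
  "constrained_velocity X \<alpha> z = velocity X (constrained \<alpha> z)"

lemma kinetic_star_eq:
  assumes "X differentiable (at (fst z, snd (snd z)))"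
  shows "kinetic_star M X \<alpha> z
    = 1 / 2 * (mass_operator M (constrained_velocity X \<alpha> z) \<bullet> constrained_velocity X \<alpha> z)"
  using assms
  by (cases z) (simp add: kinetic_star_def kinetic_def constrained_def constrained_velocity_def
      velocity_mass_weighted)

text \<open>
  The derivatives of the positions depend on the coordinates and time only, so by a velocity
  the constrained velocity is differentiated as if it were linear in the independent
  velocities and in the \<open>\<alpha> \<nu>\<close>.  The outcome involves first derivatives of \<open>X\<close> and \<open>\<alpha>\<close> only, so
  it can be differentiated once more.
\<close>

lemma constrained_velocity_derivative:
  fixes X :: "('m::finite, 'k::finite) conf \<Rightarrow> 'N::finite points"
  assumes D: "open D" "z \<in> D" and Q: "open Q" "(fst z, snd (snd z)) \<in> Q"
    and X: "Cn_on 2 X Q" and \<alpha>: "\<And>\<nu>. Cn_on 2 (\<alpha> \<nu>) D"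
  shows "constrained_velocity X \<alpha> differentiable (at z)"
    and "partial (dv i) (constrained_velocity X \<alpha>) z =
      partial (cq (Inl i)) X (fst z, snd (snd z))
      + (\<Sum>\<nu>\<in>UNIV. partial (dv i) (\<alpha> \<nu>) z *\<^sub>R partial (cq (Inr \<nu>)) X (fst z, snd (snd z)))"
proof -
  define \<kappa> :: "('m, 'k) state \<Rightarrow> ('m, 'k) conf" where "\<kappa> = (\<lambda>z. (fst z, snd (snd z)))"
  have \<kappa>: "(\<kappa> has_derivative \<kappa>) (at z)"
    unfolding \<kappa>_def by (auto intro!: derivative_eq_intros)
  have "\<forall>b\<in>Basis. \<exists>g'. (partial b X has_derivative g') (at (\<kappa> z))"
    using Cn_on_2_differentiable(2)[OF Q X] by (simp add: differentiable_def \<kappa>_def)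
  then obtain g' where g': "\<And>b. b \<in> Basis \<Longrightarrow> (partial b X has_derivative g' b) (at (\<kappa> z))"
    by metis
  have pX: "((\<lambda>z. partial b X (\<kappa> z)) has_derivative (\<lambda>h. g' b (\<kappa> h))) (at z)" if "b \<in> Basis" for b
    using has_derivative_compose[OF \<kappa> g'[OF that]] .
  have "\<forall>\<nu>. \<exists>a'. (\<alpha> \<nu> has_derivative a') (at z)"
    using Cn_on_2_differentiable(1)[OF D \<alpha>] by (simp add: differentiable_def)
  then obtain \<alpha>' where \<alpha>': "\<And>\<nu>. (\<alpha> \<nu> has_derivative \<alpha>' \<nu>) (at z)"
    by metis
  have v: "((\<lambda>z :: ('m, 'k) state. fst (snd z) $ r) has_derivative (\<lambda>h. fst (snd h) $ r)) (at z)" for r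
    by (intro bounded_linear_imp_has_derivative bounded_linear_compose[OF bounded_linear_vec_nth]
        bounded_linear_compose[OF bounded_linear_fst] bounded_linear_snd)
  have V: "constrained_velocity X \<alpha> = (\<lambda>z.
      (\<Sum>r\<in>UNIV. fst (snd z) $ r *\<^sub>R partial (cq (Inl r)) X (\<kappa> z))
      + (\<Sum>\<nu>\<in>UNIV. \<alpha> \<nu> z *\<^sub>R partial (cq (Inr \<nu>)) X (\<kappa> z)) + partial ct X (\<kappa> z))"
    by (auto simp: fun_eq_iff constrained_velocity_def velocity_def constrained_def \<kappa>_def
        sum_over_sum_type)
  have d: "(constrained_velocity X \<alpha> has_derivative (\<lambda>h.
      (\<Sum>r\<in>UNIV. fst (snd z) $ r *\<^sub>R g' (cq (Inl r)) (\<kappa> h)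
        + fst (snd h) $ r *\<^sub>R partial (cq (Inl r)) X (\<kappa> z))
      + (\<Sum>\<nu>\<in>UNIV. \<alpha> \<nu> z *\<^sub>R g' (cq (Inr \<nu>)) (\<kappa> h)
        + \<alpha>' \<nu> h *\<^sub>R partial (cq (Inr \<nu>)) X (\<kappa> z)) + g' ct (\<kappa> h))) (at z)"
    unfolding V by (intro has_derivative_add has_derivative_sum has_derivative_scaleR v pX \<alpha>') simp_all
  then show "constrained_velocity X \<alpha> differentiable (at z)"
    unfolding differentiable_def by blast
  \<comment> \<open>A variation of the velocities does not move the configuration.\<close>
  have \<kappa>0: "\<kappa> (dv i) = 0"
    by (simp add: \<kappa>_def dv_def prod_eq_iff)
  have g0: "g' b 0 = 0" if "b \<in> Basis" for b
    using has_derivative_bounded_linear[OF g'[OF that]] by (rule linear_simps)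
  have "(\<Sum>r\<in>UNIV. axis i (1::real) $ r *\<^sub>R partial (cq (Inl r)) X (\<kappa> z)) = partial (cq (Inl i)) X (\<kappa> z)"
    by (simp add: axis_def if_distrib[of "\<lambda>x. x *\<^sub>R _"] cong: if_cong)
  then show "partial (dv i) (constrained_velocity X \<alpha>) z =
      partial (cq (Inl i)) X (fst z, snd (snd z))
      + (\<Sum>\<nu>\<in>UNIV. partial (dv i) (\<alpha> \<nu>) z *\<^sub>R partial (cq (Inr \<nu>)) X (fst z, snd (snd z)))"
    using partial_eq_has_derivative[OF d, of "dv i"] partial_eq_has_derivative[OF \<alpha>', of "dv i"]
    by (simp add: \<kappa>0 g0) (simp add: dv_def \<kappa>_def)
qed

text \<open>
  The second claim does not ask for two derivatives of the kinetic energy, which already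
  contains first derivatives of \<open>X\<close> and so need be only once differentiable for \<open>X\<close> of class \<open>C\<^sup>2\<close>.
  A derivative by a velocity spends none of the regularity of \<open>X\<close>, and only one derivative of \<open>\<alpha>\<close>.
\<close>

lemma kinetic_star_differentiable:
  fixes X :: "('m::finite, 'k::finite) conf \<Rightarrow> 'N::finite points"
  assumes D: "open D" and Q: "open Q" and DQ: "\<And>y. y \<in> D \<Longrightarrow> (fst y, snd (snd y)) \<in> Q"
    and X: "Cn_on 2 X Q" and \<alpha>: "\<And>\<nu>. Cn_on 2 (\<alpha> \<nu>) D" and z: "z \<in> D"
  shows "kinetic_star M X \<alpha> differentiable (at z)"
    and "partial (dv i) (kinetic_star M X \<alpha>) differentiable (at z)"
proof -
  define V where "V = constrained_velocity X \<alpha>"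
  \<comment> \<open>The derivative of \<open>V\<close> by the \<open>i\<close>-th velocity.\<close>
  define W where "W = (\<lambda>z. partial (cq (Inl i)) X (fst z, snd (snd z))
      + (\<Sum>\<nu>\<in>UNIV. partial (dv i) (\<alpha> \<nu>) z *\<^sub>R partial (cq (Inr \<nu>)) X (fst z, snd (snd z))))"
  let ?A = "mass_operator M"
  have A: "bounded_linear ?A"
    by (rule bounded_linear_mass_operator)
  have A_diff: "(\<lambda>z. ?A (f z)) differentiable (at y)" if "f differentiable (at y)"
    for f :: "('m, 'k) state \<Rightarrow> 'N points" and y
    using that bounded_linear.has_derivative[OF A] unfolding differentiable_def by blast
  have V: "V differentiable (at y)" "partial (dv i) V y = W y" if "y \<in> D" for y
    using constrained_velocity_derivative[OF D that Q DQ[OF that] X \<alpha>]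
    by (simp_all add: V_def W_def)
  have T: "kinetic_star M X \<alpha> y = 1 / 2 * (?A (V y) \<bullet> V y)" if "y \<in> D" for y
    unfolding V_def by (rule kinetic_star_eq, rule Cn_on_2_differentiable(1)[OF Q DQ[OF that] X])
  have h: "(\<lambda>y. 1 / 2 * (?A (V y) \<bullet> V y)) differentiable (at y)"
    "partial (dv i) (\<lambda>y. 1 / 2 * (?A (V y) \<bullet> V y)) y = 1 / 2 * (?A (V y) \<bullet> W y + ?A (W y) \<bullet> V y)"
    if y: "y \<in> D" for y
  proof -
    let ?g = "\<lambda>y. ?A (V y) \<bullet> V y"
    obtain g' where g': "(?g has_derivative g') (at y)"
      using partial_inner_linear(1)[OF A V(1)[OF y]] unfolding differentiable_def by blast
    have half: "((\<lambda>y. 1 / 2 * ?g y) has_derivative (\<lambda>h. 1 / 2 * g' h)) (at y)"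
      by (rule has_derivative_mult_right[OF g'])
    then show "(\<lambda>y. 1 / 2 * ?g y) differentiable (at y)"
      unfolding differentiable_def by blast
    show "partial (dv i) (\<lambda>y. 1 / 2 * ?g y) y = 1 / 2 * (?A (V y) \<bullet> W y + ?A (W y) \<bullet> V y)"
      using partial_eq_has_derivative[OF half, of "dv i"] partial_eq_has_derivative[OF g', of "dv i"]
        partial_inner_linear(2)[OF A V(1)[OF y], of "dv i"] V(2)[OF y] by simp
  qed
  note T_diff = partial_cong_open[OF D _ T h(1)]
  show "kinetic_star M X \<alpha> differentiable (at z)"
    using T_diff(1) z by blast
  have pT: "partial (dv i) (kinetic_star M X \<alpha>) y = 1 / 2 * (?A (V y) \<bullet> W y + ?A (W y) \<bullet> V y)"
    if "y \<in> D" for y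
    using T_diff(2)[of y "dv i"] h(2) that by simp
  have W: "W differentiable (at z)"
  proof -
    have \<kappa>: "(\<lambda>z :: ('m, 'k) state. (fst z, snd (snd z))) differentiable (at z)"
      unfolding differentiable_def by (auto intro!: derivative_eq_intros exI)
    have "(\<lambda>z. partial b X (fst z, snd (snd z))) differentiable (at z)" if "b \<in> Basis" for b
      using differentiable_compose[OF Cn_on_2_differentiable(2)[OF Q DQ[OF z] X that] \<kappa>] .
    then show ?thesis
      unfolding W_def using Cn_on_2_differentiable(2)[OF D z \<alpha>]
      by (intro differentiable_add differentiable_sum differentiable_scaleR ballI) simp_all
  qed
  have "(\<lambda>y. 1 / 2 * (?A (V y) \<bullet> W y + ?A (W y) \<bullet> V y)) differentiable (at z)"
    by (intro differentiable_mult differentiable_const differentiable_add differentiable_inner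
        A_diff V(1) W z)
  from partial_cong_open(1)[where f="partial (dv i) (kinetic_star M X \<alpha>)", OF D z pT this]
  show "partial (dv i) (kinetic_star M X \<alpha>) differentiable (at z)" .
qed

text \<open>
  A coordinate direction leaves time fixed, so the spatial gradient of the potential is enough
  for the chain rule.
\<close>

lemma generalized_force_eq_partial_potential:
  fixes X :: "('m::finite, 'k::finite) conf \<Rightarrow> 'N::finite points"
  assumes X: "X differentiable (at c)"
    and F: "GDERIV (\<lambda>Y. UX (Y, snd c)) (X c) :> F (X c, snd c)"
  shows "generalized_force F X j c = partial (cq j) (potential UX X) c"
proof -
  obtain X' where X': "(X has_derivative X') (at c)"
    using X unfolding differentiable_def by blast
  have "((\<lambda>s. X (c + s *\<^sub>R cq j)) has_vector_derivative partial (cq j) X c) (at 0)"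
    using partial_has_vector_derivative[of X c 0 "cq j"] X by simp
  then have line: "((\<lambda>s. X (c + s *\<^sub>R cq j)) has_derivative (\<lambda>s. s *\<^sub>R partial (cq j) X c)) (at 0)"
    by (simp add: has_vector_derivative_def)
  have "((\<lambda>Y. UX (Y, snd c)) has_derivative (\<lambda>h. h \<bullet> F (X c, snd c))) (at (X (c + 0 *\<^sub>R cq j)))"
    using F by (simp add: gderiv_def)
  from has_derivative_compose[OF line this]
  have "((\<lambda>s. UX (X (c + s *\<^sub>R cq j), snd c)) has_vector_derivative
      F (X c, snd c) \<bullet> partial (cq j) X c) (at 0)"
    by (simp add: has_vector_derivative_def inner_commute)
  moreover have "potential UX X (c + s *\<^sub>R cq j) = UX (X (c + s *\<^sub>R cq j), snd c)" for s
    by (cases c) (simp add: potential_def cq_def)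
  ultimately have "partial (cq j) (potential UX X) c = F (X c, snd c) \<bullet> partial (cq j) X c"
    unfolding partial_def[of _ "potential UX X"] by (simp add: vector_derivative_at)
  then show ?thesis
    by (cases c) (simp add: generalized_force_def)
qed

lemma potential_differentiable:
  assumes "X differentiable (at c)" and "UX differentiable (at (X c, snd c))"
  shows "potential UX X differentiable (at c)"
proof -
  have "potential UX X = (\<lambda>c. UX (X c, snd c))"
    by (auto simp: potential_def fun_eq_iff)
  moreover have "(\<lambda>c. (X c, snd c)) differentiable (at c)"
    using assms(1) has_derivative_Pair[OF _ has_derivative_snd[OF has_derivative_ident]]
    unfolding differentiable_def by blast
  ultimately show ?thesis
    using differentiable_compose[of UX "\<lambda>c. (X c, snd c)"] assms(2) by simp
qed

lemma lagrangian_star_derivative: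
  fixes X :: "('m::finite, 'k::finite) conf \<Rightarrow> 'N::finite points"
  assumes T: "kinetic_star M X \<alpha> differentiable (at z)"
    and U: "potential UX X differentiable (at (fst z, snd (snd z)))"
  shows "lagrangian_star M X UX \<alpha> differentiable (at z)"
    and "partial (dv i) (lagrangian_star M X UX \<alpha>) z = partial (dv i) (kinetic_star M X \<alpha>) z"
    and "partial (dq j) (lagrangian_star M X UX \<alpha>) z
      = partial (dq j) (kinetic_star M X \<alpha>) z + partial (cq j) (potential UX X) (fst z, snd (snd z))"
proof -
  define \<kappa> :: "('m, 'k) state \<Rightarrow> ('m, 'k) conf" where "\<kappa> = (\<lambda>z. (fst z, snd (snd z)))"
  have \<kappa>: "(\<kappa> has_derivative \<kappa>) (at z)"
    unfolding \<kappa>_def by (auto intro!: derivative_eq_intros)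
  obtain T' where T': "(kinetic_star M X \<alpha> has_derivative T') (at z)"
    using T unfolding differentiable_def by blast
  obtain U' where U': "(potential UX X has_derivative U') (at (\<kappa> z))"
    using U unfolding differentiable_def \<kappa>_def by blast
  have L: "lagrangian_star M X UX \<alpha> = (\<lambda>z. kinetic_star M X \<alpha> z + potential UX X (\<kappa> z))"
    by (auto simp: lagrangian_star_def fun_eq_iff \<kappa>_def)
  have d: "(lagrangian_star M X UX \<alpha> has_derivative (\<lambda>h. T' h + U' (\<kappa> h))) (at z)"
    unfolding L by (rule has_derivative_add[OF T' has_derivative_compose[OF \<kappa> U']])
  then show "lagrangian_star M X UX \<alpha> differentiable (at z)"
    unfolding differentiable_def by blast
  have U0: "U' 0 = 0"
    using has_derivative_bounded_linear[OF U'] by (rule linear_simps)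
  have \<kappa>v: "\<kappa> (dv i) = 0" and \<kappa>q: "\<kappa> (dq j) = cq j"
    by (simp_all add: \<kappa>_def dv_def dq_def cq_def prod_eq_iff)
  show "partial (dv i) (lagrangian_star M X UX \<alpha>) z = partial (dv i) (kinetic_star M X \<alpha>) z"
    using partial_eq_has_derivative[OF d, of "dv i"] partial_eq_has_derivative[OF T', of "dv i"]
    by (simp add: \<kappa>v U0)
  show "partial (dq j) (lagrangian_star M X UX \<alpha>) z
      = partial (dq j) (kinetic_star M X \<alpha>) z + partial (cq j) (potential UX X) (fst z, snd (snd z))"
    using partial_eq_has_derivative[OF d, of "dq j"] partial_eq_has_derivative[OF T', of "dq j"]
      partial_eq_has_derivative[OF U', of "cq j"]
    by (simp add: \<kappa>q) (simp add: \<kappa>_def)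
qed

section \<open>The energy balance\<close>

theorem proposition2:
  fixes M :: "'N::finite \<Rightarrow> real"
    and X :: "('m::finite, 'k::finite) conf \<Rightarrow> 'N points"
    and UX :: "'N points \<times> real \<Rightarrow> real"
    and F :: "'N points \<times> real \<Rightarrow> 'N points"
    and \<alpha> :: "'k \<Rightarrow> ('m, 'k) state \<Rightarrow> real"
    and P :: "('N points \<times> real) set"
    and Q :: "('m, 'k) conf set"
    and D :: "('m, 'k) state set"
    and J :: "real set"
    and q q' q'' :: "real \<Rightarrow> real ^ ('m + 'k)"
    and z :: "real \<Rightarrow> ('m, 'k) state"
    and a :: "real \<Rightarrow> real ^ 'm"
    and Ts Ls :: "('m, 'k) state \<Rightarrow> real"
    and p :: "'k \<Rightarrow> ('m, 'k) state \<Rightarrow> real"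
  defines "Ts \<equiv> kinetic_star M X \<alpha>"
    and "Ls \<equiv> lagrangian_star M X UX \<alpha>"
    and "p \<equiv> dependent_momentum M X \<alpha>"
    and "z \<equiv> \<lambda>s. (q s, free_part (q' s), s)"
    and "a \<equiv> \<lambda>s. free_part (q'' s)"
  assumes masses: "\<And>i. M i > 0"
    and domains: "open P" "open Q" "open D"
      "\<And>x s. (x, s) \<in> Q \<Longrightarrow> (X (x, s), s) \<in> P"
      "\<And>x v s. (x, v, s) \<in> D \<Longrightarrow> (x, s) \<in> Q"
    and smooth: "Cn_on 2 X Q" "Cn_on 1 UX P" "\<And>\<nu>. Cn_on 2 (\<alpha> \<nu>) D"
    and force: "\<And>Y s. (Y, s) \<in> P \<Longrightarrow> GDERIV (\<lambda>Y. UX (Y, s)) Y :> F (Y, s)"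
    and interval: "open J" "is_interval J"
    and motion: "\<And>s. s \<in> J \<Longrightarrow> (q has_vector_derivative q' s) (at s)"
      "\<And>s. s \<in> J \<Longrightarrow> (q' has_vector_derivative q'' s) (at s)"
      "\<And>s. s \<in> J \<Longrightarrow> z s \<in> D"
    and constraints: "\<And>s \<nu>. s \<in> J \<Longrightarrow> q' s $ Inr \<nu> = \<alpha> \<nu> (z s)"
    and equations_of_motion: "\<And>s i. s \<in> J \<Longrightarrow>
      deriv (\<lambda>s. partial (dv i) Ts (z s)) s
      - partial (dq (Inl i)) Ts (z s)
      - (\<Sum>\<nu>\<in>UNIV. partial (dq (Inr \<nu>)) Ts (z s) * partial (dv i) (\<alpha> \<nu>) (z s))
      - (\<Sum>\<nu>\<in>UNIV. B_coeff \<alpha> i \<nu> (z s) (a s) * p \<nu> (z s))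
      = generalized_force F X (Inl i) (q s, s)
        + (\<Sum>\<nu>\<in>UNIV. partial (dv i) (\<alpha> \<nu>) (z s) * generalized_force F X (Inr \<nu>) (q s, s))"
  shows "(\<forall>c\<in>Q. \<forall>j. generalized_force F X j c = partial (cq j) (potential UX X) c) \<and>
    (\<forall>s\<in>J.
      (\<lambda>s. (\<Sum>i\<in>UNIV. q' s $ Inl i * partial (dv i) Ls (z s)) - Ls (z s)) differentiable at s \<and>
      deriv (\<lambda>s. (\<Sum>i\<in>UNIV. q' s $ Inl i * partial (dv i) Ls (z s)) - Ls (z s)) s
      - (\<Sum>\<nu>\<in>UNIV. (alpha_bar \<alpha> \<nu> (z s) - \<alpha> \<nu> (z s)) * partial (dq (Inr \<nu>)) Ls (z s))
      - (\<Sum>\<nu>\<in>UNIV. B_bar \<alpha> \<nu> (z s) (a s) * p \<nu> (z s))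
      = - partial dt Ls (z s)) \<and>
    (\<forall>s\<in>J. \<forall>\<nu>.
      (\<lambda>s. alpha_bar \<alpha> \<nu> (z s) - \<alpha> \<nu> (z s)) differentiable at s \<and>
      B_bar \<alpha> \<nu> (z s) (a s)
      = deriv (\<lambda>s. alpha_bar \<alpha> \<nu> (z s) - \<alpha> \<nu> (z s)) s
        - (\<Sum>\<mu>\<in>UNIV. partial (dq (Inr \<mu>)) (\<alpha> \<nu>) (z s) * (alpha_bar \<alpha> \<mu> (z s) - \<alpha> \<mu> (z s)))
        + partial dt (\<alpha> \<nu>) (z s))"
proof -
  have DQ: "(fst y, snd (snd y)) \<in> Q" if "y \<in> D" for y
    using domains(5) that by (cases y) auto
  have X_diff: "X differentiable (at c)" if "c \<in> Q" for c
    using Cn_on_2_differentiable(1)[OF domains(2) that smooth(1)] .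
  have UX_diff: "UX differentiable (at y)" if "y \<in> P" for y
    using smooth(2) at_within_open[OF that domains(1)] that
    by (simp add: differentiable_on_def) metis
  have XP: "(X c, snd c) \<in> P" if "c \<in> Q" for c
    using domains(4) that by (cases c) auto
  have gforce: "generalized_force F X j c = partial (cq j) (potential UX X) c" if "c \<in> Q" for c j
    by (rule generalized_force_eq_partial_potential[where F=F and UX=UX, OF X_diff[OF that] force[OF XP[OF that]]])
  have U_diff: "potential UX X differentiable (at c)" if "c \<in> Q" for c
    by (rule potential_differentiable[where UX=UX, OF X_diff[OF that] UX_diff[OF XP[OF that]]])
  have T_diff: "Ts differentiable (at y)" "partial (dv i) Ts differentiable (at y)" if "y \<in> D" for y i
    unfolding Ts_def
    using kinetic_star_differentiable[where X=X and \<alpha>=\<alpha> and Q=Q,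
        OF domains(3,2) DQ smooth(1,3) that] by blast+
  have L: "Ls differentiable (at y)"
    "partial (dv i) Ls y = partial (dv i) Ts y"
    "partial (dq j) Ls y = partial (dq j) Ts y + generalized_force F X j (fst y, snd (snd y))"
    if "y \<in> D" for y i j
    using lagrangian_star_derivative[OF T_diff(1)[OF that, unfolded Ts_def] U_diff[OF DQ[OF that]]]
      gforce[OF DQ[OF that]]
    by (simp_all add: Ls_def Ts_def)
  have bar_diff: "alpha_bar \<alpha> \<nu> differentiable (at y)" "\<alpha> \<nu> differentiable (at y)" if "y \<in> D" for \<nu> y
    using alpha_bar_derivative(1)[where \<alpha>=\<alpha> and \<nu>=\<nu>, OF domains(3) that smooth(3)]
      Cn_on_2_differentiable(1)[where f="\<alpha> \<nu>", OF domains(3) that smooth(3)] by blast+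
  have v_deriv: "((\<lambda>s. free_part (q' s)) has_vector_derivative a s) (at s)" if "s \<in> J" for s
  proof -
    have "linear (free_part :: real ^ ('m + 'k) \<Rightarrow> real ^ 'm)"
      by (rule linearI) (simp_all add: free_part_def vec_eq_iff)
    then have "bounded_linear (free_part :: real ^ ('m + 'k) \<Rightarrow> real ^ 'm)"
      by (simp add: linear_conv_bounded_linear)
    from bounded_linear.has_vector_derivative[OF this motion(2)[OF that]] show ?thesis
      by (simp add: a_def)
  qed
  have state: "(q s, free_part (q' s), s) = z s" for s
    by (simp add: z_def)
  have along: "((\<lambda>s. f (z s)) has_real_derivative
      (\<Sum>r\<in>UNIV. q' s $ Inl r * partial (dq (Inl r)) f (z s))
      + (\<Sum>\<nu>\<in>UNIV. \<alpha> \<nu> (z s) * partial (dq (Inr \<nu>)) f (z s))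
      + (\<Sum>r\<in>UNIV. a s $ r * partial (dv r) f (z s)) + partial dt f (z s)) (at s)"
    if "s \<in> J" "f differentiable (at (z s))" for f s
    using has_real_derivative_along_state[of f q s "\<lambda>s. free_part (q' s)", OF _ motion(1) v_deriv] that
    by (simp add: state sum_over_sum_type constraints)
  have z_simps: "fst (z s) = q s" "fst (snd (z s)) = free_part (q' s)" "snd (snd (z s)) = s" for s
    by (simp_all add: z_def)
  have vel: "free_part (q' s) $ i = q' s $ Inl i" for s i
    by (simp add: free_part_def)
  have bar: "alpha_bar \<alpha> \<nu> (z s) = (\<Sum>i\<in>UNIV. q' s $ Inl i * partial (dv i) (\<alpha> \<nu>) (z s))" for \<nu> s
    by (simp add: alpha_bar_def z_def vel)
  have B: "B_bar \<alpha> \<nu> (z s) (a s) = (\<Sum>i\<in>UNIV. q' s $ Inl i * B_coeff \<alpha> i \<nu> (z s) (a s))"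
    if "s \<in> J" for \<nu> s
    using B_bar_eq_sum_B_coeff[where \<alpha>=\<alpha> and \<nu>=\<nu>, OF domains(3) motion(3)[OF that] smooth(3)]
    by (simp add: z_simps vel)
  have energy:
    "(\<lambda>s. (\<Sum>i\<in>UNIV. q' s $ Inl i * partial (dv i) Ls (z s)) - Ls (z s)) differentiable at s \<and>
      deriv (\<lambda>s. (\<Sum>i\<in>UNIV. q' s $ Inl i * partial (dv i) Ls (z s)) - Ls (z s)) s
      - (\<Sum>\<nu>\<in>UNIV. (alpha_bar \<alpha> \<nu> (z s) - \<alpha> \<nu> (z s)) * partial (dq (Inr \<nu>)) Ls (z s))
      - (\<Sum>\<nu>\<in>UNIV. B_bar \<alpha> \<nu> (z s) (a s) * p \<nu> (z s))
      = - partial dt Ls (z s)" if s: "s \<in> J" for s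
  proof -
    have zD: "z s \<in> D"
      by (rule motion(3)[OF s])
    let ?E = "\<lambda>s. (\<Sum>i\<in>UNIV. q' s $ Inl i * partial (dv i) Ls (z s)) - Ls (z s)"
    let ?G = "\<lambda>s. (\<Sum>i\<in>UNIV. q' s $ Inl i * partial (dv i) Ts (z s)) - Ls (z s)"
    define \<pi>' where "\<pi>' i = deriv (\<lambda>s. partial (dv i) Ts (z s)) s" for i
    have \<pi>': "((\<lambda>s. partial (dv i) Ts (z s)) has_real_derivative \<pi>' i) (at s)" for i
      unfolding \<pi>'_def DERIV_deriv_iff_real_differentiable real_differentiable_def
      by (rule exI, rule along[OF s T_diff(2)[OF zD]])
    have acc: "((\<lambda>s. q' s $ Inl i) has_real_derivative a s $ i) (at s)" for i
      using bounded_linear.has_vector_derivative[OF bounded_linear_vec_nth motion(2)[OF s], of "Inl i"]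
      by (simp add: has_real_derivative_iff_has_vector_derivative a_def free_part_def)
    define L' where "L' = (\<Sum>r\<in>UNIV. q' s $ Inl r * partial (dq (Inl r)) Ls (z s))
      + (\<Sum>\<nu>\<in>UNIV. \<alpha> \<nu> (z s) * partial (dq (Inr \<nu>)) Ls (z s))
      + (\<Sum>r\<in>UNIV. a s $ r * partial (dv r) Ts (z s)) + partial dt Ls (z s)"
    have L': "((\<lambda>s. Ls (z s)) has_real_derivative L') (at s)"
      using along[OF s L(1)[OF zD]] unfolding L'_def by (simp add: L(2)[OF zD])
    \<comment> \<open>\<open>?G\<close> agrees with \<open>?E\<close> on \<open>J\<close>, as the potential does not depend on the velocities; it is
      written with the momenta that the equations of motion differentiate.\<close>
    have "(?G has_real_derivative
        (\<Sum>i\<in>UNIV. q' s $ Inl i * \<pi>' i + a s $ i * partial (dv i) Ts (z s)) - L') (at s)"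
      by (intro DERIV_diff DERIV_sum DERIV_mult' acc \<pi>' L')
    then have E': "(?E has_real_derivative
        (\<Sum>i\<in>UNIV. q' s $ Inl i * \<pi>' i + a s $ i * partial (dv i) Ts (z s)) - L') (at s)"
      by (rule has_field_derivative_transform_within_open[OF _ interval(1) s])
        (simp add: L(2)[OF motion(3)])
    \<comment> \<open>The forces are absorbed, turning the derivatives of \<open>Ts\<close> by coordinates into those of \<open>Ls\<close>.\<close>
    have eom: "\<pi>' i = partial (dq (Inl i)) Ls (z s)
        + (\<Sum>\<nu>\<in>UNIV. partial (dv i) (\<alpha> \<nu>) (z s) * partial (dq (Inr \<nu>)) Ls (z s))
        + (\<Sum>\<nu>\<in>UNIV. B_coeff \<alpha> i \<nu> (z s) (a s) * p \<nu> (z s))" for i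
      using equations_of_motion[OF s, of i] L(3)[OF zD, unfolded z_simps]
      by (simp add: \<pi>'_def[symmetric] sum.distrib ring_distribs mult.commute)
    have swap: "(\<Sum>i\<in>UNIV. q' s $ Inl i * (\<Sum>\<nu>\<in>UNIV. g i \<nu> * u \<nu>))
        = (\<Sum>\<nu>\<in>UNIV. (\<Sum>i\<in>UNIV. q' s $ Inl i * g i \<nu>) * u \<nu>)" for g :: "'m \<Rightarrow> 'k \<Rightarrow> real" and u
      unfolding sum_distrib_left sum_distrib_right by (subst sum.swap) (simp add: ac_simps)
    have power: "(\<Sum>i\<in>UNIV. q' s $ Inl i * \<pi>' i)
        = (\<Sum>i\<in>UNIV. q' s $ Inl i * partial (dq (Inl i)) Ls (z s))
        + (\<Sum>\<nu>\<in>UNIV. alpha_bar \<alpha> \<nu> (z s) * partial (dq (Inr \<nu>)) Ls (z s))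
        + (\<Sum>\<nu>\<in>UNIV. B_bar \<alpha> \<nu> (z s) (a s) * p \<nu> (z s))"
      unfolding eom by (simp add: distrib_left sum.distrib swap bar B[OF s])
    have "deriv ?E s = (\<Sum>\<nu>\<in>UNIV. (alpha_bar \<alpha> \<nu> (z s) - \<alpha> \<nu> (z s)) * partial (dq (Inr \<nu>)) Ls (z s))
        + (\<Sum>\<nu>\<in>UNIV. B_bar \<alpha> \<nu> (z s) (a s) * p \<nu> (z s)) - partial dt Ls (z s)"
      unfolding DERIV_imp_deriv[OF E'] L'_def
      by (simp add: sum.distrib power left_diff_distrib sum_subtractf)
    moreover have "?E differentiable at s"
      using E' by (auto simp: real_differentiable_def)
    ultimately show ?thesis
      by simp
  qed
  have defect:
    "(\<lambda>s. alpha_bar \<alpha> \<nu> (z s) - \<alpha> \<nu> (z s)) differentiable at s \<and>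
      B_bar \<alpha> \<nu> (z s) (a s)
      = deriv (\<lambda>s. alpha_bar \<alpha> \<nu> (z s) - \<alpha> \<nu> (z s)) s
        - (\<Sum>\<mu>\<in>UNIV. partial (dq (Inr \<mu>)) (\<alpha> \<nu>) (z s) * (alpha_bar \<alpha> \<mu> (z s) - \<alpha> \<mu> (z s)))
        + partial dt (\<alpha> \<nu>) (z s)" if s: "s \<in> J" for s \<nu>
  proof -
    note d = DERIV_diff[OF along[OF s bar_diff(1)[OF motion(3)[OF s]]]
        along[OF s bar_diff(2)[OF motion(3)[OF s]]], of \<nu> \<nu>]
    have "B_bar \<alpha> \<nu> (z s) (a s) =
        (\<Sum>r\<in>UNIV. q' s $ Inl r *
          (partial (dq (Inl r)) (alpha_bar \<alpha> \<nu>) (z s) - partial (dq (Inl r)) (\<alpha> \<nu>) (z s)))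
        + (\<Sum>\<mu>\<in>UNIV. \<alpha> \<mu> (z s) * partial (dq (Inr \<mu>)) (alpha_bar \<alpha> \<nu>) (z s)
            - alpha_bar \<alpha> \<mu> (z s) * partial (dq (Inr \<mu>)) (\<alpha> \<nu>) (z s))
        + (\<Sum>r\<in>UNIV. a s $ r *
          (partial (dv r) (alpha_bar \<alpha> \<nu>) (z s) - partial (dv r) (\<alpha> \<nu>) (z s)))
        + partial dt (alpha_bar \<alpha> \<nu>) (z s)"
      by (simp add: B_bar_def z_def vel Let_def)
    then have "B_bar \<alpha> \<nu> (z s) (a s)
      = deriv (\<lambda>s. alpha_bar \<alpha> \<nu> (z s) - \<alpha> \<nu> (z s)) s
        - (\<Sum>\<mu>\<in>UNIV. partial (dq (Inr \<mu>)) (\<alpha> \<nu>) (z s) * (alpha_bar \<alpha> \<mu> (z s) - \<alpha> \<mu> (z s)))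
        + partial dt (\<alpha> \<nu>) (z s)"
      unfolding DERIV_imp_deriv[OF d]
      by (simp add: right_diff_distrib sum_subtractf mult.commute)
    moreover have "(\<lambda>s. alpha_bar \<alpha> \<nu> (z s) - \<alpha> \<nu> (z s)) differentiable at s"
      using d by (auto simp: real_differentiable_def)
    ultimately show ?thesis
      by simp
  qed
  show ?thesis
    using gforce energy defect by blast
qed

end
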